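(* Let $f$ and $g$ be two probability densities on the circle $\mathbb{S}^{1}\cong\mathbb{R}/\mathbb{Z}$, with cumulative distribution functions $F,G:\mathbb{R}\to\mathbb{R}$ and inverse distribution functions $F^{-1},G^{-1}:\mathbb{R}\to\mathbb{R}$ (as defined in the context). For $\alpha\in\mathbb{R}$ let $G^{\alpha}:=G+\alpha$. Then the quadratic Wasserstein distance on $\mathbb{S}^{1}$ takes the form $$W_{2}^{2}(f,g)=\inf_{\alpha\in\mathbb{R}}\int_{0}^{1}\left|F^{-1}(t)-(G^{\alpha})^{-1}(t)\right|^{2}\,\mathrm{d}t.$$ Moreover, the optimal transport map from $f$ to $g$ is given by $T(t)=\left((G^{\alpha^{*}})^{-1}\circ F\right)(t)$ (read modulo $1$ as a map of $\mathbb{S}^{1}$), where $\alpha^{*}$ is the point at which the infimum above is attained.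
   Context: The circle is $\mathbb{S}^{1}\cong\mathbb{R}/\mathbb{Z}$ with representative interval $[0,1)$ and geodesic distance $d(x,y)=\min\{|x-y|,\,1-|x-y|\}$ for representatives $x,y\in[0,1)$. A probability density $f$ on $\mathbb{S}^1$ is a nonnegative function of unit mass on $[0,1)$; it is extended to $\mathbb{R}$ by $f(t+1)=f(t)$. Its cumulative distribution function is $F(t)=\int_0^t f(\tau)\,\mathrm{d}\tau$ on $[0,1]$, extended to $\mathbb{R}$ by $F(t+1)=F(t)+1$. Its inverse distribution function is $F^{-1}(y)=\inf\{t: y<F(t)\}$, which satisfies $F^{-1}(y+1)=F^{-1}(y)+1$. $G$ and $G^{-1}$ are defined from $g$ in the same way, and $(G^{\alpha})^{-1}(y)=\inf\{t: y<G(t)+\alpha\}=G^{-1}(y-\alpha)$. With $\mathrm{d}\mu=f\,\mathrm{d}x$ and $\mathrm{d}\nu=g\,\mathrm{d}y$, the quadratic Wasserstein distance is $$W_2^2(f,g)=W_2^2(\mu,\nu)=\inf_{T\in\Pi(\mu,\nu)}\int_{\mathbb{S}^1} d(x,T(x))^2\,\mathrm{d}\mu(x),$$ where $\Pi(\mu,\nu)$ is the set of (measurable) maps $T:\mathbb{S}^1\to\mathbb{S}^1$ with $\nu(B)=\mu(T^{-1}(B))$ for all (Borel) $B\subset\mathbb{S}^1$. The optimal transport map is the minimizer $T$ in this problem (understood up to $\mu$-null sets). *)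

theory Defs
  imports "HOL-Analysis.Analysis"
begin

text \<open>
  The circle \<open>\<real>/\<int>\<close> is represented by \<open>{0..<1}\<close>.  Functions on the circle are 1-periodic
  functions on the reals; self-maps of the circle are considered on \<open>{0..<1}\<close> only.
\<close>

definition circle_dist :: "real \<Rightarrow> real \<Rightarrow> real" where
  "circle_dist x y = min \<bar>x - y\<bar> (1 - \<bar>x - y\<bar>)"

definition circle_density :: "(real \<Rightarrow> real) \<Rightarrow> bool" where
  "circle_density f \<longleftrightarrow>
     f \<in> borel_measurable lebesgue \<and>
     (\<forall>t. 0 \<le> f t) \<and>
     (\<forall>t. f (t + 1) = f t) \<and>
     set_integrable lebesgue {0..<1} f \<and>
     (LINT t:{0..<1}|lebesgue. f t) = 1"

text \<open>
  The integral from \<open>0\<close> to \<open>t\<close> for \<open>t\<close> in \<open>{0..<1}\<close>, extended by \<open>F (t + 1) = F t + 1\<close>;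
  at \<open>t = 1\<close> this gives \<open>1\<close>, the total mass.
\<close>
definition circle_cdf :: "(real \<Rightarrow> real) \<Rightarrow> real \<Rightarrow> real" where
  "circle_cdf f t = of_int \<lfloor>t\<rfloor> + (LINT \<tau>:{0..frac t}|lebesgue. f \<tau>)"

definition inverse_df :: "(real \<Rightarrow> real) \<Rightarrow> real \<Rightarrow> real" where
  "inverse_df H y = Inf {t. y < H t}"

definition circle_measure :: "(real \<Rightarrow> real) \<Rightarrow> real measure" where
  "circle_measure f = density (lebesgue_on {0..<1}) (\<lambda>x. ennreal (f x))"

text \<open>
  The maps live on the Lebesgue sets of \<open>{0..<1}\<close>, since densities are only assumed to be
  Lebesgue measurable; their values are tested on Borel sets.
\<close>
definition transport_maps :: "(real \<Rightarrow> real) \<Rightarrow> (real \<Rightarrow> real) \<Rightarrow> (real \<Rightarrow> real) set" where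
  "transport_maps f g =
     {T. T \<in> measurable (circle_measure f) (restrict_space borel {0..<1}) \<and>
         (\<forall>B \<in> sets borel. B \<subseteq> {0..<1} \<longrightarrow>
            emeasure (circle_measure g) B = emeasure (circle_measure f) (T -` B \<inter> {0..<1}))}"

definition transport_cost :: "(real \<Rightarrow> real) \<Rightarrow> (real \<Rightarrow> real) \<Rightarrow> real" where
  "transport_cost f T = (LINT x|circle_measure f. (circle_dist x (T x))\<^sup>2)"

definition wasserstein2_sq :: "(real \<Rightarrow> real) \<Rightarrow> (real \<Rightarrow> real) \<Rightarrow> real" where
  "wasserstein2_sq f g = (INF T\<in>transport_maps f g. transport_cost f T)"

definition cost_minimizer :: "(real \<Rightarrow> real) \<Rightarrow> (real \<Rightarrow> real) \<Rightarrow> (real \<Rightarrow> real) \<Rightarrow> bool" where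
  "cost_minimizer f g T \<longleftrightarrow> T \<in> transport_maps f g \<and> transport_cost f T = wasserstein2_sq f g"

text \<open>
  ``The'' optimal map is a minimizer, unique up to null sets of the source measure.
\<close>
definition is_optimal_transport_map :: "(real \<Rightarrow> real) \<Rightarrow> (real \<Rightarrow> real) \<Rightarrow> (real \<Rightarrow> real) \<Rightarrow> bool" where
  "is_optimal_transport_map f g T \<longleftrightarrow>
     cost_minimizer f g T \<and>
     (\<forall>S. cost_minimizer f g S \<longrightarrow> (AE x in circle_measure f. S x = T x))"

definition shifted_inverse_df :: "(real \<Rightarrow> real) \<Rightarrow> real \<Rightarrow> real \<Rightarrow> real" where
  "shifted_inverse_df g \<alpha> = inverse_df (\<lambda>t. circle_cdf g t + \<alpha>)"

definition shift_cost :: "(real \<Rightarrow> real) \<Rightarrow> (real \<Rightarrow> real) \<Rightarrow> real \<Rightarrow> real" where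
  "shift_cost f g \<alpha> =
     (LINT t:{0..1}|lebesgue. \<bar>inverse_df (circle_cdf f) t - shifted_inverse_df g \<alpha> t\<bar>\<^sup>2)"

end

theory Submission
  imports Defs
begin

text \<open>
  Kantorovich duality with an explicit potential.  Pick \<open>\<alpha>\<close> and a nondecreasing lift \<open>S\<close> of the
  circle, lying between the left- and right-continuous versions of \<open>F\<^sup>-\<^sup>1 \<circ> (G + \<alpha>)\<close>, whose mean
  displacement \<open>\<integral> (S s - s) ds\<close> over a period vanishes.  Then
  \<open>\<psi> y = \<integral> 2 (s - S s) ds\<close> (from \<open>0\<close> to \<open>y\<close>) is periodic, and since \<open>S\<close> crosses the level \<open>x\<close>
  at \<open>\<theta> x = G\<^sup>-\<^sup>1 (F x - \<alpha>)\<close>, the function \<open>y \<mapsto> (x - y)\<^sup>2 - \<psi> y\<close> on the real line has its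
  only minimum at \<open>\<theta> x\<close>, for almost every \<open>x\<close>.  Integrating this inequality along
  any transport map, or along the lift belonging to any other shift, bounds both costs from below by the same
  dual value; equality forces the map to be \<open>\<theta>\<close> modulo \<open>1\<close>, respectively the shift to be \<open>\<alpha>\<close>.
\<close>

section \<open>Primitives of periodic functions\<close>


text \<open>For 1-periodic \<open>p\<close> this is the oriented integral of \<open>p\<close> from 0
  to \<open>t\<close>, for \<open>t\<close> of either sign. The form mirrors
  \<open>circle_cdf\<close>.\<close>

definition periodic_primitive :: "(real \<Rightarrow> real) \<Rightarrow> real \<Rightarrow> real" where
  "periodic_primitive p t = of_int \<lfloor>t\<rfloor> * integral {0..1} p + integral {0..frac t} p"

lemma periodic_add_int:
  fixes p :: "real \<Rightarrow> 'a" and n :: int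
  assumes "\<And>t. p (t + 1) = p t"
  shows "p (t + of_int n) = p t"
proof (induction n rule: int_induct[where k = 0])
  case (step1 i)
  then show ?case using assms[of "t + of_int i"] by (simp add: add.assoc)
next
  case (step2 i)
  then show ?case using assms[of "t + of_int (i - 1)"] by (simp add: algebra_simps)
qed simp

lemma periodic_frac:
  fixes p :: "real \<Rightarrow> 'a"
  assumes "\<And>t. p (t + 1) = p t"
  shows "p (frac t) = p t"
  using periodic_add_int[of p "frac t" "\<lfloor>t\<rfloor>"] assms by (simp add: frac_def)

lemma periodic_primitive_plus_one:
  "periodic_primitive p (t + 1) = periodic_primitive p t + integral {0..1} p"
  by (simp add: periodic_primitive_def frac_def algebra_simps)

text \<open>Translation settles one unit cell, induction on the number of cells settles intervals
  starting at an integer, and a general \<open>a\<close> follows by splitting at \<open>a\<close>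
  the interval that starts at its floor.\<close>

lemma has_integral_periodic_primitive:
  fixes p :: "real \<Rightarrow> real"
  assumes per: "\<And>t. p (t + 1) = p t" and int: "p integrable_on {0..1}" and "a \<le> b"
  shows "(p has_integral periodic_primitive p b - periodic_primitive p a) {a..b}"
proof -
  let ?P = "periodic_primitive p"
  have unit: "(p has_integral ?P x - ?P (of_int m)) {of_int m..x}"
    if "of_int m \<le> x" "x \<le> of_int m + 1" for m :: int and x
  proof -
    have P: "?P x = of_int m * integral {0..1} p + integral {0..x - of_int m} p"
    proof (cases "x = of_int m + 1")
      case True
      then show ?thesis by (simp add: periodic_primitive_def algebra_simps frac_def)
    next
      case False
      then have "\<lfloor>x\<rfloor> = m" using that by linarith
      then show ?thesis by (simp add: periodic_primitive_def frac_def)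
    qed
    have "p integrable_on {0..x - of_int m}"
      by (rule integrable_subinterval_real[OF int]) (use that in auto)
    then have "(p has_integral integral {0..x - of_int m} p) {0..x - of_int m}"
      by blast
    from has_integral_shift_real_ivl[OF this, of "- of_int m"]
    have "((\<lambda>t. p (t - of_int m)) has_integral integral {0..x - of_int m} p) {of_int m..x}"
      by simp
    moreover have "p (t - of_int m) = p t" for t
      using periodic_add_int[of p t "- m"] per by simp
    moreover have "?P (of_int m) = of_int m * integral {0..1} p"
      by (simp add: periodic_primitive_def)
    ultimately show ?thesis using P by simp
  qed
  have from_int: "(p has_integral ?P x - ?P (of_int m)) {of_int m..x}"
    if "of_int m \<le> x" "x \<le> of_int m + real k" for m :: int and x k
    using that
  proof (induction k arbitrary: m)
    case 0
    then have "x = of_int m" by simp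
    then show ?case using has_integral_refl(2)[of p x] by simp
  next
    case (Suc k)
    show ?case
    proof (cases "x \<le> of_int m + 1")
      case True
      then show ?thesis using Suc unit by simp
    next
      case False
      have 1: "(p has_integral ?P (of_int (m + 1)) - ?P (of_int m)) {of_int m..of_int (m + 1)}"
        by (rule unit) auto
      have 2: "(p has_integral ?P x - ?P (of_int (m + 1))) {of_int (m + 1)..x}"
        by (rule Suc.IH) (use False Suc.prems in auto)
      show ?thesis
        using has_integral_combine[OF _ _ 1 2] False by simp
    qed
  qed
  define k where "k = nat \<lceil>b - of_int \<lfloor>a\<rfloor>\<rceil>"
  have k: "b \<le> of_int \<lfloor>a\<rfloor> + real k" unfolding k_def using \<open>a \<le> b\<close> by linarith
  have ia: "(p has_integral ?P a - ?P (of_int \<lfloor>a\<rfloor>)) {of_int \<lfloor>a\<rfloor>..a}"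
    by (rule from_int[of _ _ k]) (use k \<open>a \<le> b\<close> in auto)
  have ib: "(p has_integral ?P b - ?P (of_int \<lfloor>a\<rfloor>)) {of_int \<lfloor>a\<rfloor>..b}"
    by (rule from_int[of _ _ k]) (use k \<open>a \<le> b\<close> in linarith)+
  have fa: "of_int \<lfloor>a\<rfloor> \<le> a" by simp
  have iab: "p integrable_on {a..b}"
    by (rule integrable_subinterval_real[OF has_integral_integrable[OF ib]]) (use fa in auto)
  have "integral {of_int \<lfloor>a\<rfloor>..a} p + integral {a..b} p = integral {of_int \<lfloor>a\<rfloor>..b} p"
    by (rule Henstock_Kurzweil_Integration.integral_combine) (use fa \<open>a \<le> b\<close> ib in auto)
  then have "integral {a..b} p = ?P b - ?P a"
    using ia ib by (simp add: integral_unique)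
  with iab show ?thesis by (metis integrable_integral)
qed

text \<open>Around \<open>x\<close> the primitive is a constant plus the integral from
  \<open>x - 1\<close>, so nothing has to be glued at the integers.\<close>

lemma continuous_periodic_primitive:
  fixes p :: "real \<Rightarrow> real"
  assumes per: "\<And>t. p (t + 1) = p t" and int: "p integrable_on {0..1}"
  shows "continuous_on UNIV (periodic_primitive p)"
proof -
  have "isCont (periodic_primitive p) x" for x
  proof -
    have hi: "(p has_integral periodic_primitive p y - periodic_primitive p (x - 1)) {x - 1..y}"
      if "x - 1 \<le> y" for y
      using has_integral_periodic_primitive[OF per int] that by blast
    have "continuous_on {x - 1..x + 1} (\<lambda>y. integral {x - 1..y} p)"
      using hi[of "x + 1"] by (intro indefinite_integral_continuous_1) auto
    then have "continuous_on {x - 1..x + 1} (\<lambda>y. periodic_primitive p (x - 1) + integral {x - 1..y} p)"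
      by (intro continuous_intros)
    then have "continuous_on {x - 1..x + 1} (periodic_primitive p)"
      by (rule continuous_on_eq) (simp add: integral_unique[OF hi])
    then have "continuous_on {x - 1<..<x + 1} (periodic_primitive p)"
      by (rule continuous_on_subset) auto
    then show ?thesis
      by (simp add: continuous_on_eq_continuous_at)
  qed
  then show ?thesis by (simp add: continuous_at_imp_continuous_on)
qed

lemma negligible_Ico_Icc:
  "negligible {x \<in> {0..<1} - {0..1::real}. P x}" "negligible {x \<in> {0..1::real} - {0..<1}. P x}"
  by (rule negligible_subset[of "{1::real}"]; force)+

lemma circle_density_integrable:
  assumes "circle_density f"
  shows "f absolutely_integrable_on {0..1}" "integral {0..1} f = 1"
proof -
  have i: "f absolutely_integrable_on {0..<1}" and l: "(LINT t:{0..<1}|lebesgue. f t) = 1"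
    using assms by (auto simp: circle_density_def)
  show "f absolutely_integrable_on {0..1}"
    using i absolutely_integrable_spike_set_eq[OF negligible_Ico_Icc] by blast
  have "(f has_integral 1) {0..<1}"
    using has_integral_set_lebesgue[OF i] l by simp
  then have "(f has_integral 1) {0..1}"
    using has_integral_spike_set_eq[OF negligible_Ico_Icc] by blast
  then show "integral {0..1} f = 1" by blast
qed

lemma circle_cdf_eq:
  assumes "circle_density f"
  shows "circle_cdf f = periodic_primitive f"
proof
  fix t
  have "f absolutely_integrable_on {0..frac t}"
    using circle_density_integrable(1)[OF assms]
    by (rule set_integrable_subset) (use less_imp_le[OF frac_lt_1, of t] in auto)
  then show "circle_cdf f t = periodic_primitive f t"
    by (simp add: circle_cdf_def periodic_primitive_def circle_density_integrable[OF assms]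
        set_lebesgue_integral_eq_integral)
qed

section \<open>Monotone lifts of degree one and their inverses\<close>

text \<open>The arguments about inverses use a distribution function only through these properties.
  Flat pieces are allowed, so \<open>H\<close> may fail to be injective and its inverse may
  jump.\<close>

locale circle_lift =
  fixes H :: "real \<Rightarrow> real"
  assumes mono: "mono H" and cont: "continuous_on UNIV H"
    and zero: "H 0 = 0" and step: "\<And>t. H (t + 1) = H t + 1"
begin

lemma monoD: "x \<le> y \<Longrightarrow> H x \<le> H y"
  using mono by (simp add: mono_def)

lemma less_imp: "H x < H y \<Longrightarrow> x < y"
  using monoD[of y x] by linarith

text \<open>The displacement \<open>H t - t\<close> is 1-periodic, and over the unit interval both
  \<open>H\<close> and the identity stay between 0 and 1.\<close>

lemma bounds: "t - 1 \<le> H t" "H t \<le> t + 1"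
proof -
  have p: "H (s + 1) - (s + 1) = H s - s" for s by (simp add: step)
  have e: "H (frac t) - frac t = H t - t"
    using periodic_frac[of "\<lambda>s. H s - s" t] p by simp
  have "H 1 = 1" using step[of 0] zero by simp
  then have "0 \<le> H (frac t)" "H (frac t) \<le> 1"
    using monoD[of 0 "frac t"] monoD[of "frac t" 1] zero by (auto simp: less_imp_le[OF frac_lt_1])
  then show "t - 1 \<le> H t" "H t \<le> t + 1"
    using e frac_ge_0[of t] frac_lt_1[of t] by linarith+
qed

abbreviation R where "R \<equiv> inverse_df H"

lemma nonempty: "{t. y < H t} \<noteq> {}"
proof -
  have "y < H (y + 2)" using bounds(1)[of "y + 2"] by linarith
  then show ?thesis by blast
qed

lemma bdd: "bdd_below {t. y < H t}"
proof (rule bdd_belowI[of _ "y - 1"])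
  fix t assume "t \<in> {t. y < H t}"
  then show "y - 1 \<le> t" using bounds(2)[of t] by simp
qed

lemma R_le: "y < H t \<Longrightarrow> R y \<le> t"
  unfolding inverse_df_def by (rule cInf_lower) (auto intro: bdd)

lemma R_ge: "(\<And>s. y < H s \<Longrightarrow> t \<le> s) \<Longrightarrow> t \<le> R y"
  unfolding inverse_df_def by (rule cInf_greatest) (use nonempty in auto)

lemma le_R: "H t \<le> y \<Longrightarrow> t \<le> R y"
proof (rule R_ge)
  fix s assume "H t \<le> y" "y < H s"
  then have "H t < H s" by linarith
  then show "t \<le> s" using less_imp by (simp add: less_imp_le)
qed

lemma H_le: "t < R y \<Longrightarrow> H t \<le> y"
  using R_le[of y t] by linarith

lemma less_H:
  assumes "R y < t" shows "y < H t"
proof -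
  obtain s where "y < H s" "s < t"
    using assms R_ge[of y t] by (meson not_le)
  then show ?thesis using monoD[of s t] by linarith
qed

lemma R_bounds: "y - 1 \<le> R y" "R y \<le> y + 1"
proof -
  show "y - 1 \<le> R y" by (rule le_R) (use bounds(2)[of "y - 1"] in simp)
  show "R y \<le> y + 1"
  proof (rule ccontr)
    assume "\<not> R y \<le> y + 1"
    then obtain t where "y + 1 < t" "t < R y" using dense by (meson not_le)
    then show False using H_le[of t y] bounds(1)[of t] by linarith
  qed
qed

text \<open>To the left of \<open>R y\<close> the values of \<open>H\<close> are at most
  \<open>y\<close>, to the right they exceed \<open>y\<close>; continuity forces equality at
  \<open>R y\<close>.\<close>

lemma H_R: "H (R y) = y"
proof (rule antisym)
  have c: "isCont H (R y)" using cont by (simp add: continuous_on_eq_continuous_at)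
  have l: "(H \<longlongrightarrow> H (R y)) (at_left (R y))" and r: "(H \<longlongrightarrow> H (R y)) (at_right (R y))"
    using c by (auto simp: isCont_def filterlim_at_split)
  show "H (R y) \<le> y"
    by (rule tendsto_upperbound[OF l]) (auto intro!: eventually_at_leftI[of "R y - 1"] H_le)
  show "y \<le> H (R y)"
    by (rule tendsto_lowerbound[OF r])
      (auto intro!: eventually_at_rightI[of _ "R y + 1"] less_imp_le less_H)
qed

lemma R_strict: "x < y \<Longrightarrow> R x < R y"
  using less_imp[of "R x" "R y"] by (simp add: H_R)

lemma R_mono: "mono R"
  by (rule monoI) (metis R_strict order_le_less)

lemma R_inj: "R x = R y \<Longrightarrow> x = y"
  by (metis H_R)

lemma R_step: "R (y + 1) = R y + 1"
proof (rule antisym)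
  have "y < H (t - 1)" if "y + 1 < H t" for t
    using step[of "t - 1"] that by simp
  then show "R y + 1 \<le> R (y + 1)"
    using R_le[of y] by (intro R_ge) force
  have "R (y + 1) - 1 \<le> R y"
  proof (rule R_ge)
    fix s assume "y < H s"
    then have "R (y + 1) \<le> s + 1" by (intro R_le) (simp add: step)
    then show "R (y + 1) - 1 \<le> s" by simp
  qed
  then show "R (y + 1) \<le> R y + 1" by simp
qed

lemma R_borel[measurable]: "R \<in> borel_measurable borel"
  by (rule borel_measurable_mono[OF R_mono])

lemma H_borel[measurable]: "H \<in> borel_measurable borel"
  by (rule borel_measurable_mono[OF mono])

lemma value_left:
  assumes "y < H a"
  obtains t where "t < a" "y < H t"
proof -
  have "isCont H a" using cont by (simp add: continuous_on_eq_continuous_at)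
  then have "(H \<longlongrightarrow> H a) (at_left a)" by (auto simp: isCont_def filterlim_at_split)
  then have "eventually (\<lambda>t. y < H t) (at_left a)" using assms by (simp add: order_tendsto_iff)
  moreover have "eventually (\<lambda>t. t < a) (at_left a)"
    by (auto intro!: eventually_at_leftI[of "a - 1"])
  ultimately have "eventually (\<lambda>t. y < H t \<and> t < a) (at_left a)"
    by eventually_elim auto
  then show ?thesis using that eventually_happens by fastforce
qed

text \<open>These are levels, not points: the heights of the flat pieces of \<open>H\<close>, which
  are the places where \<open>R\<close> jumps.\<close>

definition plateau :: "real set" where
  "plateau = {v. \<exists>a b. a < b \<and> H a = v \<and> H b = v}"

text \<open>Every flat piece contains a rational, so its level is a value of \<open>H\<close> at a
  rational.\<close>

lemma countable_plateau: "countable plateau"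
proof -
  have "plateau \<subseteq> H ` \<rat>"
  proof
    fix v assume "v \<in> plateau"
    then obtain a b where "a < b" "H a = v" "H b = v" by (auto simp: plateau_def)
    moreover obtain q where "q \<in> \<rat>" "a < q" "q < b"
      using Rats_dense_in_real[OF \<open>a < b\<close>] by blast
    ultimately have "H q = v" using monoD[of a q] monoD[of q b] by simp
    then show "v \<in> H ` \<rat>" using \<open>q \<in> \<rat>\<close> by blast
  qed
  then show ?thesis by (metis countable_image countable_rat countable_subset)
qed

lemma strict_off_plateau:
  assumes "H x \<notin> plateau"
  shows "t < x \<Longrightarrow> H t < H x" "x < t \<Longrightarrow> H x < H t"
proof -
  have n: "\<not> (H a = H x \<and> H b = H x)" if "a < b" for a b
    using assms that unfolding plateau_def by blast
  show "H t < H x" if "t < x" using n[OF that] monoD[of t x] that by auto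
  show "H x < H t" if "x < t" using n[OF that] monoD[of x t] that by auto
qed

lemma R_H: "H x \<notin> plateau \<Longrightarrow> R (H x) = x"
  using strict_off_plateau[of x "R (H x)"] by (metis H_R linorder_neqE_linordered_idom order_less_irrefl)

end

lemma circle_lift_cdf:
  assumes "circle_density f"
  shows "circle_lift (circle_cdf f)"
proof
  have i: "f integrable_on {0..1}"
    using circle_density_integrable[OF assms] set_lebesgue_integral_eq_integral by blast
  have p: "\<And>t. f (t + 1) = f t" and nn: "\<And>t. 0 \<le> f t" using assms by (auto simp: circle_density_def)
  show "mono (circle_cdf f)"
  proof (rule monoI)
    fix x y :: real assume "x \<le> y"
    from has_integral_periodic_primitive[OF p i this]
    have "0 \<le> periodic_primitive f y - periodic_primitive f x"
      by (rule has_integral_nonneg) (rule nn)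
    then show "circle_cdf f x \<le> circle_cdf f y" by (simp add: circle_cdf_eq[OF assms])
  qed
  show "continuous_on UNIV (circle_cdf f)"
    by (simp add: circle_cdf_eq[OF assms] continuous_periodic_primitive[OF p i])
  show "circle_cdf f 0 = 0"
    by (simp add: circle_cdf_eq[OF assms] periodic_primitive_def)
  show "circle_cdf f (t + 1) = circle_cdf f t + 1" for t
    by (simp add: circle_cdf_eq[OF assms] periodic_primitive_plus_one circle_density_integrable[OF assms])
qed


text \<open>Beyond the midpoint \<open>m\<close> monotonicity bounds \<open>k\<close> below by the
  positive constant \<open>k m\<close>, and the left half contributes a nonnegative amount.\<close>

lemma mono_has_integral_pos:
  fixes k :: "real \<Rightarrow> real"
  assumes "mono k" "a < b" "(k has_integral D) {a..b}" and pos: "\<And>s. a < s \<Longrightarrow> s \<le> b \<Longrightarrow> 0 < k s"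
  shows "0 < D"
proof -
  define m where "m = (a + b) / 2"
  have m: "a < m" "m < b" using \<open>a < b\<close> by (auto simp: m_def)
  have i: "k integrable_on {a..m}" "k integrable_on {m..b}"
    using assms(3) m by (auto intro!: integrable_subinterval_real[OF has_integral_integrable])
  have "D = integral {a..m} k + integral {m..b} k"
    using Henstock_Kurzweil_Integration.integral_combine[of a m b k] m assms(3) by (auto simp: integral_unique)
  \<comment> \<open>The sign of \<open>k\<close> at \<open>a\<close> itself is unknown; altering
    that single point leaves the integral unchanged.\<close>
  moreover have "((\<lambda>s. max 0 (k s)) has_integral integral {a..m} k) {a..m}"
  proof (rule has_integral_spike_finite[of "{a}" _ _ k])
    show "max 0 (k s) = k s" if "s \<in> {a..m} - {a}" for s
      using pos[of s] m that by simp
  qed (use i(1) in auto)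
  then have "0 \<le> integral {a..m} k"
    by (rule has_integral_nonneg) simp
  moreover have "((\<lambda>s. k m) has_integral (b - m) * k m) {m..b}"
    using has_integral_const_real[of "k m" m b] m by simp
  then have "(b - m) * k m \<le> integral {m..b} k"
    by (rule has_integral_le[OF _ integrable_integral[OF i(2)]]) (use \<open>mono k\<close> in \<open>simp add: mono_def\<close>)
  moreover have "0 < (b - m) * k m" using m pos[of m] by simp
  ultimately show ?thesis by linarith
qed

lemma mono_has_integral_neg:
  fixes k :: "real \<Rightarrow> real"
  assumes "mono k" "a < b" "(k has_integral D) {a..b}" and neg: "\<And>s. a \<le> s \<Longrightarrow> s < b \<Longrightarrow> k s < 0"
  shows "D < 0"
proof -
  have "((\<lambda>s. k (- s)) has_integral D) {- b..- a}"
    using assms(3) by (subst has_integral_reflect_real) auto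
  then have "((\<lambda>s. - k (- s)) has_integral - D) {- b..- a}"
    by (rule has_integral_neg)
  then have "0 < - D"
    by (rule mono_has_integral_pos[rotated 2]) (use assms neg in \<open>auto simp: mono_def\<close>)
  then show ?thesis by simp
qed

section \<open>One-sided continuity of the two inverses\<close>

context circle_lift
begin

lemma R_lessI: "y < H x \<Longrightarrow> R y < x"
proof -
  assume "y < H x"
  then obtain t where "t < x" "y < H t" by (rule value_left)
  then show "R y < x" using R_le[of y t] by simp
qed

text \<open>From below monotonicity is enough; from above, \<open>R y < b\<close> gives
  \<open>y < H b\<close>, which leaves room to increase \<open>y\<close>.\<close>

lemma R_right_tendsto: "(\<lambda>n. R (y + inverse (real (Suc n)))) \<longlonglongrightarrow> R y"
proof (rule order_tendstoI)
  fix a assume "a < R y"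
  moreover have "R y \<le> R (y + inverse (real (Suc n)))" for n
    using R_mono by (simp add: mono_def)
  ultimately show "\<forall>\<^sub>F n in sequentially. a < R (y + inverse (real (Suc n)))"
    by (simp add: less_le_trans del: of_nat_Suc)
next
  fix b assume "R y < b"
  then have "y < H b" by (rule less_H)
  then have "0 < H b - y" by simp
  from order_tendstoD(2)[OF LIMSEQ_inverse_real_of_nat this]
  show "\<forall>\<^sub>F n in sequentially. R (y + inverse (real (Suc n))) < b"
    by eventually_elim (rule R_lessI, simp)
qed

text \<open>Conjugation by \<open>t \<mapsto> - t\<close> exchanges left and right, so facts about
  \<open>R\<close> yield their mirror images for the left-continuous inverse.\<close>

lemma reflect: "circle_lift (\<lambda>t. - H (- t))"
proof
  show "mono (\<lambda>t. - H (- t))" using mono by (simp add: mono_def)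
  show "continuous_on UNIV (\<lambda>t. - H (- t))"
    by (intro continuous_intros continuous_on_compose2[OF cont]) auto
  show "- H (- 0) = 0" by (simp add: zero)
  show "- H (- (t + 1)) = - H (- t) + 1" for t
    using step[of "- 1 - t"] by (simp add: algebra_simps)
qed

text \<open>The left-continuous inverse \<open>y \<mapsto> sup {t. H t < y}\<close>, obtained by reflection.\<close>

definition L :: "real \<Rightarrow> real" where
  "L y = - inverse_df (\<lambda>t. - H (- t)) (- y)"

lemma L_mono: "mono L"
  using circle_lift.R_mono[OF reflect] by (simp add: mono_def L_def)

lemma L_step: "L (y + 1) = L y + 1"
  using circle_lift.R_step[OF reflect, of "- 1 - y"] by (simp add: L_def algebra_simps)

lemma L_bounds: "y - 1 \<le> L y" "L y \<le> y + 1"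
  using circle_lift.R_bounds[OF reflect, of "- y"] by (simp_all add: L_def)

lemma L_greater: "H x < y \<Longrightarrow> x < L y"
  using circle_lift.R_lessI[OF reflect, of "- y" "- x"] by (simp add: L_def)

lemma L_le_R: "L y \<le> R y"
  using circle_lift.le_R[OF reflect, of "- R y" "- y"] by (simp add: L_def H_R)

lemma L_left_tendsto: "(\<lambda>n. L (y - inverse (real (Suc n)))) \<longlonglongrightarrow> L y"
  using tendsto_minus[OF circle_lift.R_right_tendsto[OF reflect, of "- y"]] by (simp add: L_def)

end

section \<open>A Kantorovich potential\<close>

locale circle_lift_pair = F: circle_lift F + G: circle_lift G for F G
begin

lemma displacement_integrable:
  assumes "mono h"
  shows "(\<lambda>s. h (G s + \<alpha>) - s) integrable_on {0..1}"
proof (rule integrable_diff)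
  show "(\<lambda>s. h (G s + \<alpha>)) integrable_on {0..1}"
    using assms G.mono by (intro integrable_on_mono_on) (simp add: mono_on_def mono_def)
  show "(\<lambda>s. s) integrable_on {0..1::real}" by (simp add: ident_integrable_on)
qed

text \<open>Dominated convergence with a bound uniform in \<open>n\<close>. It is applied to the
  right-continuous inverse with positive \<open>\<beta> n\<close> and to the left-continuous one
  with negative \<open>\<beta> n\<close>.\<close>

lemma displacement_tendsto:
  assumes "mono h" and b: "\<And>y. y - 1 \<le> h y" "\<And>y. h y \<le> y + 1" and "\<And>n. \<bar>\<beta> n\<bar> \<le> 1"
    and lim: "\<And>y. (\<lambda>n. h (y + \<beta> n)) \<longlonglongrightarrow> h y"
  shows "(\<lambda>n. integral {0..1} (\<lambda>s. h (G s + (\<alpha> + \<beta> n)) - s))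
           \<longlonglongrightarrow> integral {0..1} (\<lambda>s. h (G s + \<alpha>) - s)"
proof (rule dominated_convergence(2)[where h = "\<lambda>_. \<bar>\<alpha>\<bar> + 3"])
  show "(\<lambda>s. h (G s + (\<alpha> + \<beta> n)) - s) integrable_on {0..1}" for n
    by (rule displacement_integrable[OF assms(1)])
  show "norm (h (G s + (\<alpha> + \<beta> n)) - s) \<le> \<bar>\<alpha>\<bar> + 3" for n s
    using b[of "G s + (\<alpha> + \<beta> n)"] G.bounds[of s] assms(4)[of n] unfolding real_norm_def by linarith
  show "(\<lambda>n. h (G s + (\<alpha> + \<beta> n)) - s) \<longlonglongrightarrow> h (G s + \<alpha>) - s" for s
    using tendsto_diff[OF lim[of "G s + \<alpha>"] tendsto_const[of s]] by (simp add: add.assoc)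
qed (rule integrable_const_ivl)

text \<open>
  The mean displacement of the monotone lifts \<open>F\<^sup>-\<^sup>1 \<circ> (G + \<alpha>)\<close> may jump over zero if \<open>F\<close> and
  \<open>G\<close> both have plateaus; interpolating between the two one-sided inverses of \<open>F\<close>
  at the critical \<open>\<alpha>\<close> makes it vanish.
\<close>

lemma balanced_lift:
  obtains S \<alpha> where "mono S" "\<And>t. S (t + 1) = S t + 1" "integral {0..1} (\<lambda>s. S s - s) = 0"
    "\<And>s. F.L (G s + \<alpha>) \<le> S s" "\<And>s. S s \<le> F.R (G s + \<alpha>)"
proof -
  define J where "J h \<alpha> = integral {0..1} (\<lambda>s. h (G s + \<alpha>) - s)" for h \<alpha>
  note int = displacement_integrable
  have Jmono: "J F.R \<alpha> \<le> J F.R \<beta>" if "\<alpha> \<le> \<beta>" for \<alpha> \<beta>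
    unfolding J_def by (rule integral_le)
      (use that F.R_mono in \<open>auto intro: int simp: mono_def\<close>)
  \<comment> \<open>The inverse of \<open>F\<close> and \<open>G\<close> each move a point by at
    most 1, so a shift by -2 makes the displacement nonpositive; likewise a shift by 3 makes it at
    least 1.\<close>
  have "J F.R (- 2) \<le> integral {0..1} (\<lambda>s::real. 0::real)"
    unfolding J_def
  proof (rule integral_le)
    fix s show "F.R (G s + - 2) - s \<le> 0"
      using F.R_bounds[of "G s + - 2"] G.bounds[of s] by linarith
  qed (use int[OF F.R_mono, of "- 2"] in auto)
  then have low: "J F.R (- 2) \<le> 0" by simp
  have "integral {0..1} (\<lambda>s::real. 1::real) \<le> J F.R 3"
    unfolding J_def
  proof (rule integral_le)
    fix s show "1 \<le> F.R (G s + 3) - s"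
      using F.R_bounds[of "G s + 3"] G.bounds[of s] by linarith
  qed (use int[OF F.R_mono, of 3] in auto)
  then have high: "0 < J F.R 3" by simp
  \<comment> \<open>\<open>J F.R\<close> is nondecreasing but may jump, so only a change of sign at
    \<open>Sup A\<close> can be located, not a zero.\<close>
  define A where "A = {\<alpha>. J F.R \<alpha> \<le> 0}"
  have bdd: "bdd_above A"
  proof (rule bdd_aboveI[of _ 3])
    fix \<alpha> assume "\<alpha> \<in> A"
    then show "\<alpha> \<le> 3" using Jmono[of 3 \<alpha>] high unfolding A_def by force
  qed
  have ne: "A \<noteq> {}" using low by (auto simp: A_def)
  define \<alpha> where "\<alpha> = Sup A"
  have below: "J F.R \<beta> \<le> 0" if "\<beta> < \<alpha>" for \<beta>
  proof -
    obtain \<gamma> where "\<gamma> \<in> A" "\<beta> < \<gamma>"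
      using less_cSupD[OF ne, of \<beta>] \<open>\<beta> < \<alpha>\<close> unfolding \<alpha>_def by blast
    then show ?thesis using Jmono[of \<beta> \<gamma>] by (simp add: A_def)
  qed
  have above: "0 \<le> J F.R \<beta>" if "\<alpha> < \<beta>" for \<beta>
    using that cSup_upper[OF _ bdd, of \<beta>] unfolding \<alpha>_def A_def by force
  have e: "\<bar>inverse (real (Suc n))\<bar> \<le> 1" for n by (simp add: field_simps)
  have "(\<lambda>n. J F.R (\<alpha> + inverse (real (Suc n)))) \<longlonglongrightarrow> J F.R \<alpha>"
    unfolding J_def
    by (rule displacement_tendsto) (use e F.R_mono F.R_bounds F.R_right_tendsto in auto)
  then have r: "0 \<le> J F.R \<alpha>"
    by (rule LIMSEQ_le_const) (auto intro!: above)
  \<comment> \<open>To the left of \<open>\<alpha>\<close> the sign is known for \<open>F.R\<close>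
    only; \<open>F.L\<close> lies below it and is left-continuous, so its sign survives the
    limit.\<close>
  have "(\<lambda>n. J F.L (\<alpha> + - inverse (real (Suc n)))) \<longlonglongrightarrow> J F.L \<alpha>"
    unfolding J_def
    by (rule displacement_tendsto) (use e F.L_mono F.L_bounds F.L_left_tendsto in auto)
  moreover have "J F.L (\<alpha> + - inverse (real (Suc n))) \<le> 0" for n
  proof -
    have "J F.L (\<alpha> + - inverse (real (Suc n))) \<le> J F.R (\<alpha> + - inverse (real (Suc n)))"
      unfolding J_def by (rule integral_le) (auto intro: int F.R_mono F.L_mono F.L_le_R)
    also have "\<dots> \<le> 0" by (rule below) simp
    finally show ?thesis .
  qed
  ultimately have l: "J F.L \<alpha> \<le> 0"
    by (meson LIMSEQ_le_const2)
  obtain c where c: "0 \<le> c" "c \<le> 1" "(1 - c) * J F.L \<alpha> + c * J F.R \<alpha> = 0"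
  proof (cases "J F.L \<alpha> = J F.R \<alpha>")
    case True
    then show ?thesis using l r that[of 0] by simp
  next
    case False
    then have "J F.L \<alpha> < J F.R \<alpha>" using l r by simp
    then show ?thesis
      using that[of "- J F.L \<alpha> / (J F.R \<alpha> - J F.L \<alpha>)"] l r by (simp add: field_simps)
  qed
  define S where "S s = (1 - c) * F.L (G s + \<alpha>) + c * F.R (G s + \<alpha>)" for s
  show ?thesis
  proof
    show "mono S"
    proof (rule monoI)
      fix x y :: real assume "x \<le> y"
      then have "G x + \<alpha> \<le> G y + \<alpha>" using G.monoD by simp
      then show "S x \<le> S y"
        unfolding S_def using c F.L_mono F.R_mono by (intro add_mono mult_left_mono) (auto simp: mono_def)
    qed
    show "S (t + 1) = S t + 1" for t
    proof -
      have "G (t + 1) + \<alpha> = (G t + \<alpha>) + 1" by (simp add: G.step)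
      then show ?thesis
        unfolding S_def by (simp only: F.L_step F.R_step) (simp add: algebra_simps)
    qed
    have "integral {0..1} (\<lambda>s. S s - s) =
        integral {0..1} (\<lambda>s. (1 - c) * (F.L (G s + \<alpha>) - s) + c * (F.R (G s + \<alpha>) - s))"
      by (simp add: S_def algebra_simps)
    also have "\<dots> = (1 - c) * J F.L \<alpha> + c * J F.R \<alpha>"
      unfolding J_def using int[OF F.L_mono, of \<alpha>] int[OF F.R_mono, of \<alpha>]
      by (subst Henstock_Kurzweil_Integration.integral_add)
         (auto intro: integrable_on_mult_right)
    finally show "integral {0..1} (\<lambda>s. S s - s) = 0" using c by simp
    fix s
    have d: "0 \<le> F.R (G s + \<alpha>) - F.L (G s + \<alpha>)" using F.L_le_R by simp
    have "S s = F.L (G s + \<alpha>) + c * (F.R (G s + \<alpha>) - F.L (G s + \<alpha>))"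
      "S s = F.R (G s + \<alpha>) - (1 - c) * (F.R (G s + \<alpha>) - F.L (G s + \<alpha>))"
      by (simp_all add: S_def algebra_simps)
    then show "F.L (G s + \<alpha>) \<le> S s" "S s \<le> F.R (G s + \<alpha>)"
      using mult_nonneg_nonneg[OF c(1) d] mult_nonneg_nonneg[OF _ d, of "1 - c"] c(2) by linarith+
  qed
qed

text \<open>For fixed \<open>x\<close> the function \<open>y \<mapsto> (x - y)^2 - \<psi> y\<close>
  is a primitive of the nondecreasing \<open>2 * (S y - x)\<close>, which is negative before
  \<open>\<theta>\<close> and positive after it.\<close>

lemma kantorovich_potential:
  obtains \<alpha> \<psi> where "continuous_on UNIV \<psi>" "\<And>t. \<psi> (t + 1) = \<psi> t"
    "\<And>x y. F x - \<alpha> \<notin> G.plateau \<Longrightarrow> y \<noteq> G.R (F x - \<alpha>) \<Longrightarrow>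
       (x - G.R (F x - \<alpha>))\<^sup>2 - \<psi> (G.R (F x - \<alpha>)) < (x - y)\<^sup>2 - \<psi> y"
proof -
  obtain S \<alpha> where mono: "mono S" and step: "\<And>t. S (t + 1) = S t + 1"
    and zero: "integral {0..1} (\<lambda>s. S s - s) = 0"
    and S: "\<And>s. F.L (G s + \<alpha>) \<le> S s" "\<And>s. S s \<le> F.R (G s + \<alpha>)"
    by (rule balanced_lift) blast
  define p where "p s = 2 * (s - S s)" for s
  define \<psi> where "\<psi> = periodic_primitive p"
  have p: "p (t + 1) = p t" for t by (simp add: p_def step)
  have "(\<lambda>s. - 2 * (S s - s)) integrable_on {0..1}"
    using mono by (intro integrable_on_mult_right integrable_diff ident_integrable_on integrable_on_mono_on)
      (auto simp: mono_def mono_on_def)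
  then have i: "p integrable_on {0..1}"
    by (simp add: p_def[abs_def] algebra_simps)
  have "integral {0..1} p = - 2 * integral {0..1} (\<lambda>s. S s - s)"
    unfolding integral_mult_right[symmetric] by (simp add: p_def[abs_def] algebra_simps)
  then have "\<psi> (t + 1) = \<psi> t" for t
    by (simp add: \<psi>_def periodic_primitive_plus_one zero)
  moreover have "continuous_on UNIV \<psi>"
    unfolding \<psi>_def by (rule continuous_periodic_primitive[OF p i])
  moreover have "(x - \<theta>)\<^sup>2 - \<psi> \<theta> < (x - y)\<^sup>2 - \<psi> y"
    if np: "F x - \<alpha> \<notin> G.plateau" and "y \<noteq> \<theta>" and \<theta>: "\<theta> = G.R (F x - \<alpha>)" for x y \<theta>
  proof -
    define k where "k s = 2 * (S s - x)" for s
    have k: "mono k" using mono by (simp add: k_def mono_def)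
    have D: "(k has_integral ((x - b)\<^sup>2 - \<psi> b) - ((x - a)\<^sup>2 - \<psi> a)) {a..b}" if "a \<le> b" for a b
    proof -
      have "((\<lambda>s. 2 * (s - x)) has_integral (x - b)\<^sup>2 - (x - a)\<^sup>2) {a..b}"
        by (rule fundamental_theorem_of_calculus[OF that])
          (auto intro!: derivative_eq_intros simp flip: has_real_derivative_iff_has_vector_derivative)
      from has_integral_diff[OF this has_integral_periodic_primitive[OF p i that]]
      show ?thesis by (simp add: k_def[abs_def] p_def \<psi>_def algebra_simps)
    qed
    have gt: "0 < k s" if "\<theta> < s" for s
      using G.less_H[of "F x - \<alpha>" s] that F.L_greater[of x "G s + \<alpha>"] S(1)[of s] by (simp add: k_def \<theta>)
    \<comment> \<open>Left of \<open>\<theta>\<close> the inverse only gives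
      \<open>G s \<le> F x - \<alpha>\<close>. Equality would make \<open>G\<close> flat from
      \<open>s\<close> to \<open>\<theta>\<close>, which \<open>np\<close> rules out.\<close>
    have lt: "k s < 0" if "s < \<theta>" for s
    proof -
      have "G s \<noteq> F x - \<alpha>" using np that G.H_R[of "F x - \<alpha>"] by (force simp: G.plateau_def \<theta>)
      then have "G s + \<alpha> < F x" using G.H_le[of s "F x - \<alpha>"] that by (simp add: \<theta>)
      then show ?thesis using F.R_lessI S(2)[of s] by (fastforce simp: k_def)
    qed
    show ?thesis
    proof (cases "\<theta> < y")
      case True
      have "0 < ((x - y)\<^sup>2 - \<psi> y) - ((x - \<theta>)\<^sup>2 - \<psi> \<theta>)"
        by (rule mono_has_integral_pos[OF k True D]) (use True gt in auto)
      then show ?thesis by simp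
    next
      case False
      then have "y < \<theta>" using \<open>y \<noteq> \<theta>\<close> by simp
      then have "((x - \<theta>)\<^sup>2 - \<psi> \<theta>) - ((x - y)\<^sup>2 - \<psi> y) < 0"
        by (intro mono_has_integral_neg[OF k _ D]) (use lt in auto)
      then show ?thesis by simp
    qed
  qed
  ultimately show ?thesis using that by blast
qed

end

section \<open>Push-forwards\<close>


text \<open>Links the gauge integral used for primitives to the uniform law that appears in
  \<open>distr_F\<close>.\<close>

lemma unit_interval_integral:
  fixes h :: "real \<Rightarrow> real"
  assumes [measurable]: "h \<in> borel_measurable borel" and b: "\<And>t. \<bar>h t\<bar> \<le> C"
  shows "h absolutely_integrable_on {0..1}"
    and "(\<integral>t. h t \<partial>density lborel (indicator {0..1})) = integral {0..1} h"
proof -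
  have "set_integrable lborel {0..1::real} (\<lambda>t. C)"
    by (rule borel_integrable_atLeastAtMost') (rule continuous_on_const)
  then have i: "set_integrable lborel {0..1} h"
    unfolding set_integrable_def
    by (rule Bochner_Integration.integrable_bound) (auto simp: indicator_def intro!: AE_I2 order_trans[OF b] abs_ge_self)
  then show "h absolutely_integrable_on {0..1}"
    unfolding set_integrable_def by (subst integrable_completion) auto
  have "(\<integral>t. h t \<partial>density lborel (indicator {0..1})) =
        (\<integral>t. h t \<partial>density lborel (\<lambda>t. ennreal (indicator {0..1} t)))"
    by (simp add: ennreal_indicator)
  also have "\<dots> = (LINT t:{0..1}|lborel. h t)"
    unfolding set_lebesgue_integral_def by (subst integral_density) auto
  also have "\<dots> = integral {0..1} h"
    by (rule set_borel_integral_eq_integral(2)[OF i])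
  finally show "(\<integral>t. h t \<partial>density lborel (indicator {0..1})) = integral {0..1} h" .
qed

text \<open>Over any interval of length one the primitive grows by the same amount, wherever that
  interval starts.\<close>

lemma integral_periodic_shift:
  fixes p :: "real \<Rightarrow> real"
  assumes "\<And>t. p (t + 1) = p t" "p integrable_on {0..1}"
  shows "integral {0..1} (\<lambda>t. p (t - \<alpha>)) = integral {0..1} p"
proof -
  have "(p has_integral periodic_primitive p (1 - \<alpha>) - periodic_primitive p (- \<alpha>)) {- \<alpha>..1 - \<alpha>}"
    by (rule has_integral_periodic_primitive[OF assms]) simp
  moreover have "periodic_primitive p (1 - \<alpha>) = periodic_primitive p (- \<alpha>) + integral {0..1} p"
    using periodic_primitive_plus_one[of p "- \<alpha>"] by (simp add: add.commute)
  ultimately have "(p has_integral integral {0..1} p) {- \<alpha>..1 - \<alpha>}" by simp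
  from has_integral_shift_real_ivl[OF this, of "- \<alpha>"] show ?thesis
    by (simp add: integral_unique)
qed

section \<open>Circle distance and distance on the real line\<close>

lemma circle_dist_le:
  assumes "0 \<le> x" "x < 1"
  shows "circle_dist x (frac w) \<le> \<bar>x - w\<bar>"
proof -
  have w: "w = frac w + of_int \<lfloor>w\<rfloor>" by (simp add: frac_def)
  consider "\<lfloor>w\<rfloor> = 0" | "1 \<le> \<lfloor>w\<rfloor>" | "\<lfloor>w\<rfloor> \<le> -1" by linarith
  then show ?thesis
  proof cases
    case 1
    then show ?thesis using w by (simp add: circle_dist_def)
  next
    case 2
    then have "1 \<le> real_of_int \<lfloor>w\<rfloor>" by simp
    then show ?thesis using w assms frac_ge_0[of w] frac_lt_1[of w] unfolding circle_dist_def by linarith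
  next
    case 3
    then have "real_of_int \<lfloor>w\<rfloor> \<le> -1" by simp
    then show ?thesis using w assms frac_ge_0[of w] frac_lt_1[of w] unfolding circle_dist_def by linarith
  qed
qed

text \<open>One of \<open>y\<close>, \<open>y + 1\<close>, \<open>y - 1\<close> lies within 1/2 of
  \<open>x\<close>, and it realises the minimum.\<close>

lemma circle_dist_attained:
  assumes "0 \<le> x" "x < 1" "0 \<le> y" "y < 1"
  obtains w where "frac w = y" "circle_dist x y = \<bar>x - w\<bar>"
proof -
  have fr: "frac (y + of_int n) = y" for n :: int
    using assms by (simp add: frac_eq frac_def floor_eq_iff)
  show ?thesis
  proof (cases "\<bar>x - y\<bar> \<le> 1 / 2")
    case True
    then show ?thesis using fr[of 0] by (intro that[of y]) (auto simp: circle_dist_def)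
  next
    case False
    show ?thesis
    proof (cases "y \<le> x")
      case True
      then show ?thesis using fr[of 1] False assms by (intro that[of "y + 1"]) (auto simp: circle_dist_def)
    next
      case y: False
      then show ?thesis using fr[of "-1"] False assms by (intro that[of "y - 1"]) (auto simp: circle_dist_def)
    qed
  qed
qed

lemma circle_dist_sq_le_1:
  assumes "0 \<le> x" "x < 1" "0 \<le> y" "y < 1"
  shows "(circle_dist x y)\<^sup>2 \<le> 1"
proof -
  have "\<bar>circle_dist x y\<bar> \<le> 1" using assms by (auto simp: circle_dist_def)
  then show ?thesis by (simp add: abs_square_le_1)
qed

lemma borel_measurable_frac[measurable]: "frac \<in> borel_measurable (borel :: real measure)"
  unfolding frac_def[abs_def] by measurable

section \<open>The measure of a density and its push-forward by the distribution function\<close>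

locale density_on_circle =
  fixes f :: "real \<Rightarrow> real"
  assumes density: "circle_density f"

sublocale density_on_circle \<subseteq> circle_lift "circle_cdf f"
  by (rule circle_lift_cdf[OF density])

context density_on_circle
begin

abbreviation M where "M \<equiv> circle_measure f"
abbreviation F where "F \<equiv> circle_cdf f"

lemma space_M[simp]: "space M = {0..<1}"
  by (simp add: circle_measure_def space_restrict_space)

lemma measurable_borel_M: "h \<in> borel_measurable borel \<Longrightarrow> h \<in> borel_measurable M"
  unfolding circle_measure_def measurable_cong_sets[OF sets_density refl]
  by (intro measurable_restrict_space1 measurable_completion) simp

lemma emeasure_has_integral:
  assumes A: "A \<in> sets lebesgue" "A \<subseteq> {0..<1}" and I: "(f has_integral I) A"
  shows "emeasure M A = ennreal I"
proof -
  have f: "f \<in> borel_measurable lebesgue" and nn: "\<And>t. 0 \<le> f t"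
    using density by (auto simp: circle_density_def)
  have s: "A \<in> sets (lebesgue_on {0..<1::real})"
    using A by (auto simp: sets_restrict_space)
  have "emeasure M A = (\<integral>\<^sup>+x. ennreal (f x) * indicator A x \<partial>lebesgue_on {0..<1})"
    unfolding circle_measure_def using f s
    by (intro emeasure_density) (auto intro!: measurable_restrict_space1)
  also have "\<dots> = (\<integral>\<^sup>+x. ennreal (f x) * indicator A x * indicator {0..<1} x \<partial>lebesgue)"
    by (intro nn_integral_restrict_space) auto
  also have "\<dots> = (\<integral>\<^sup>+x. ennreal (f x) * indicator A x \<partial>lebesgue)"
    using A by (intro nn_integral_cong) (auto simp: indicator_def)
  also have "\<dots> = ennreal I"
    using nn_integral_has_integral_lebesgue'[OF _ I] nn by (simp add: nn_integral_completion)
  finally show ?thesis .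
qed

lemma has_integral_F:
  assumes "c \<le> 1"
  shows "(f has_integral 1 - F c) {c..1}"
proof -
  have per: "\<And>t. f (t + 1) = f t"
    using density by (auto simp: circle_density_def)
  have i: "f integrable_on {0..1}"
    using circle_density_integrable[OF density] set_lebesgue_integral_eq_integral by blast
  show ?thesis
    using has_integral_periodic_primitive[OF per i assms] step[of 0] zero
    by (simp add: circle_cdf_eq[OF density])
qed

text \<open>The probability integral transform. Rays \<open>{v<..}\<close> suffice to compare the
  two measures, and for \<open>v\<close> in \<open>{0..<1}\<close> continuity of \<open>F\<close>
  makes the preimage of the ray an interval of mass \<open>1 - v\<close>.\<close>

lemma distr_F: "distr M borel F = density lborel (indicator {0..1})"
proof (rule measure_eqI_lessThan)
  have Fm: "F \<in> borel_measurable M" by (rule measurable_borel_M) measurable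
  have one: "F 1 = 1" using step[of 0] zero by simp
  have full: "emeasure M {0..<1} = 1"
  proof -
    have "(f has_integral 1) {0..<1}"
      using has_integral_F[of 0] zero has_integral_spike_set_eq[OF negligible_Ico_Icc, of f] by auto
    from emeasure_has_integral[OF _ _ this] show ?thesis by simp
  qed
  have Ioo: "emeasure M {c<..<1} = ennreal (1 - F c)" if "0 \<le> c" "c \<le> 1" for c
    using that has_integral_F[of c]
    by (intro emeasure_has_integral) (auto simp: has_integral_Icc_iff_Ioo)
  have L: "emeasure (distr M borel F) {v<..} = ennreal (1 - max 0 (min 1 v))" for v
  proof -
    have "emeasure (distr M borel F) {v<..} = emeasure M {x \<in> {0..<1}. v < F x}"
      using Fm by (subst emeasure_distr) (auto intro!: arg_cong[where f = "emeasure M"])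
    also have "\<dots> = ennreal (1 - max 0 (min 1 v))"
    proof -
      consider "v < 0" | "1 \<le> v" | "0 \<le> v" "v < 1" by linarith
      then show ?thesis
      proof cases
        case 1
        then have "v < F x" if "0 \<le> x" for x using monoD[OF that] zero by simp
        then have "{x \<in> {0..<1}. v < F x} = {0..<1}" by auto
        then show ?thesis using 1 full by simp
      next
        case 2
        have "F x \<le> v" if "x < 1" for x using monoD[of x 1] that one 2 by simp
        then have e: "{x \<in> {0..<1}. v < F x} = {}" by force
        show ?thesis unfolding e using 2 by simp
      next
        case 3
        have r: "0 \<le> R v" "R v < 1" using le_R[of 0 v] R_lessI[of v 1] 3 zero one by auto
        \<comment> \<open>\<open>R v\<close> is the largest point at level \<open>v\<close>, so the
          superlevel set is the open interval after it and \<open>H_R\<close> gives its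
          mass.\<close>
        have iff: "v < F x \<longleftrightarrow> R v < x" for x by (rule iffI) (erule R_lessI, erule less_H)
        have "{x \<in> {0..<1}. v < F x} = {R v<..<1}" unfolding iff using r by auto
        then show ?thesis using Ioo[of "R v"] r 3 by (simp add: H_R)
      qed
    qed
    finally show ?thesis .
  qed
  have U: "emeasure (density lborel (indicator {0..1})) {v<..} = ennreal (1 - max 0 (min 1 v))" for v :: real
  proof -
    have "emeasure (density lborel (indicator {0..1})) {v<..} = emeasure lborel ({0..1} \<inter> {v<..})"
      by (subst emeasure_density) (auto simp: nn_integral_set_ennreal[symmetric] simp flip: indicator_inter_arith)
    also have "\<dots> = ennreal (1 - max 0 (min 1 v))"
    proof -
      consider "v < 0" | "1 \<le> v" | "0 \<le> v" "v < 1" by linarith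
      then show ?thesis
      proof cases
        case 1
        then have "{0..1} \<inter> {v<..} = {0..1}" by auto
        then show ?thesis using 1 by simp
      next
        case 2
        then have "{0..1} \<inter> {v<..} = {}" by auto
        then show ?thesis using 2 by simp
      next
        case 3
        then have "{0..1} \<inter> {v<..} = {v<..1}" by auto
        then show ?thesis using 3 by simp
      qed
    qed
    finally show ?thesis .
  qed
  show "emeasure (distr M borel F) {x<..} < \<infinity>" for x by (simp add: L)
  show "emeasure (distr M borel F) {x<..} = emeasure (density lborel (indicator {0..1})) {x<..}" for x
    by (simp only: L U)
qed simp_all

lemma emeasure_space_M: "emeasure M (space M) = 1"
proof -
  have "emeasure (distr M borel F) UNIV = emeasure M (space M)"
    using measurable_borel_M[OF H_borel] by (subst emeasure_distr) auto
  then show ?thesis by (simp add: distr_F emeasure_density)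
qed

lemma finite_M: "finite_measure M"
  by standard (simp add: emeasure_space_M del: space_M)

lemma integrable_M:
  fixes h :: "real \<Rightarrow> real"
  assumes "h \<in> borel_measurable M" "\<And>x. 0 \<le> x \<Longrightarrow> x < 1 \<Longrightarrow> \<bar>h x\<bar> \<le> C"
  shows "integrable M h"
  using assms by (intro finite_measure.integrable_const_bound[OF finite_M, where B = C] AE_I2) auto

lemma integral_F:
  fixes h :: "real \<Rightarrow> real"
  assumes [measurable]: "h \<in> borel_measurable borel" and b: "\<And>t. \<bar>h t\<bar> \<le> C"
  shows "(\<integral>x. h (F x) \<partial>M) = integral {0..1} h"
proof -
  have "(\<integral>x. h (F x) \<partial>M) = (\<integral>t. h t \<partial>distr M borel F)"
    by (rule integral_distr[symmetric]) (auto intro: measurable_borel_M)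
  then show ?thesis by (simp add: distr_F unit_interval_integral(2)[OF assms])
qed

text \<open>The value \<open>F x\<close> is uniformly distributed, and countable sets are null for
  Lebesgue measure.\<close>

lemma AE_F_notin:
  assumes "countable A"
  shows "AE x in M. F x \<notin> A"
proof -
  have "AE t in density lborel (indicator {0..1}). t \<notin> A"
    using AE_not_in[OF countable_imp_null_set_lborel[OF assms]] by (subst AE_density) auto
  then have "AE t in distr M borel F. t \<notin> A" unfolding distr_F .
  then show ?thesis by (rule AE_distrD[rotated]) (auto intro: measurable_borel_M)
qed

lemma AE_R_F: "AE x in M. R (F x) = x"
  using AE_F_notin[OF countable_plateau] by eventually_elim (rule R_H)

text \<open>The inverse pushes the uniform law back to \<open>M\<close>, since
  \<open>R (F x) = x\<close> almost everywhere. Periodicity of \<open>h\<close> together with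
  \<open>R_step\<close> absorbs the shift by \<open>\<alpha>\<close>.\<close>

lemma integral_R:
  fixes h :: "real \<Rightarrow> real"
  assumes [measurable]: "h \<in> borel_measurable borel" and b: "\<And>t. \<bar>h t\<bar> \<le> C"
    and per: "\<And>t. h (t + 1) = h t"
  shows "integral {0..1} (\<lambda>t. h (R (t - \<alpha>))) = (\<integral>x. h x \<partial>M)"
proof -
  have i: "(\<lambda>t. h (R t)) integrable_on {0..1}"
    by (intro set_lebesgue_integral_eq_integral(1) unit_interval_integral(1)[where C = C]) (auto simp: b)
  have "integral {0..1} (\<lambda>t. h (R (t - \<alpha>))) = integral {0..1} (\<lambda>t. h (R t))"
    by (rule integral_periodic_shift[of "\<lambda>t. h (R t)", OF _ i]) (simp add: R_step per)
  also have "\<dots> = (\<integral>x. h (R (F x)) \<partial>M)"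
    by (rule integral_F[symmetric, where C = C]) (auto simp: b)
  also have "\<dots> = (\<integral>x. h x \<partial>M)"
    using AE_R_F by (intro integral_cong_AE measurable_borel_M) auto
  finally show ?thesis .
qed

end


section \<open>Duality\<close>

locale transport_pair = f: density_on_circle f + g: density_on_circle g for f g
begin

text \<open>The candidate map before reduction modulo 1. Keeping it real-valued lets its squared
  displacement be compared with \<open>shift_cost\<close>.\<close>

definition lift :: "real \<Rightarrow> real \<Rightarrow> real" where
  "lift \<alpha> x = g.R (f.F x - \<alpha>)"

lemma shifted_inverse_df_eq: "shifted_inverse_df g \<alpha> y = g.R (y - \<alpha>)"
  by (simp add: shifted_inverse_df_def inverse_df_def algebra_simps)

lemma lift_borel[measurable]: "lift \<alpha> \<in> borel_measurable borel"
  unfolding lift_def[abs_def] by measurable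

lemma lift_bound: "\<bar>x - lift \<alpha> x\<bar> \<le> 2 + \<bar>\<alpha>\<bar>"
  using g.R_bounds[of "f.F x - \<alpha>"] f.bounds[of x] unfolding lift_def by linarith

lemma lift_sq_bound: "(x - lift \<alpha> x)\<^sup>2 \<le> (2 + \<bar>\<alpha>\<bar>)\<^sup>2"
  using lift_bound[of x \<alpha>] by (simp add: abs_le_square_iff[symmetric])

text \<open>Every shift transports \<open>f\<close> to \<open>g\<close> modulo 1: \<open>F\<close>
  makes the law uniform, and the shifted inverse turns it into that of \<open>g\<close>. Periodic
  test functions see only classes modulo 1.\<close>

lemma integral_lift:
  fixes h :: "real \<Rightarrow> real"
  assumes [measurable]: "h \<in> borel_measurable borel" and b: "\<And>t. \<bar>h t\<bar> \<le> C"
    and per: "\<And>t. h (t + 1) = h t"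
  shows "(\<integral>x. h (lift \<alpha> x) \<partial>f.M) = (\<integral>y. h y \<partial>g.M)"
proof -
  have "(\<integral>x. h (lift \<alpha> x) \<partial>f.M) = integral {0..1} (\<lambda>t. h (g.R (t - \<alpha>)))"
    unfolding lift_def by (rule f.integral_F[where C = C]) (auto simp: b)
  then show ?thesis using g.integral_R[OF assms, of \<alpha>] by simp
qed

text \<open>Substitution \<open>t = F x\<close>, under which the inverse of \<open>F\<close> becomes
  the identity almost everywhere.\<close>

lemma shift_cost_eq: "shift_cost f g \<alpha> = (\<integral>x. (x - lift \<alpha> x)\<^sup>2 \<partial>f.M)"
proof -
  define h where "h t = (f.R t - g.R (t - \<alpha>))\<^sup>2" for t
  have [measurable]: "h \<in> borel_measurable borel" unfolding h_def[abs_def] by measurable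
  have b: "\<bar>h t\<bar> \<le> (2 + \<bar>\<alpha>\<bar>)\<^sup>2" for t
  proof -
    have "\<bar>f.R t - g.R (t - \<alpha>)\<bar> \<le> 2 + \<bar>\<alpha>\<bar>"
      using f.R_bounds[of t] g.R_bounds[of "t - \<alpha>"] by linarith
    then show ?thesis by (simp add: h_def abs_le_square_iff[symmetric])
  qed
  have "shift_cost f g \<alpha> = integral {0..1} h"
    unfolding shift_cost_def shifted_inverse_df_eq power2_abs h_def[symmetric]
    by (intro set_lebesgue_integral_eq_integral(2) unit_interval_integral(1)[where C = "(2 + \<bar>\<alpha>\<bar>)\<^sup>2"])
      (auto simp: b)
  also have "\<dots> = (\<integral>x. h (f.F x) \<partial>f.M)"
    by (rule f.integral_F[symmetric, OF _ b]) measurable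
  also have "\<dots> = (\<integral>x. (x - lift \<alpha> x)\<^sup>2 \<partial>f.M)"
    using f.AE_R_F by (intro integral_cong_AE f.measurable_borel_M) (auto simp: h_def lift_def)
  finally show ?thesis .
qed

lemma frac_lift_transport: "(\<lambda>x. frac (lift \<alpha> x)) \<in> transport_maps f g"
proof -
  have m: "(\<lambda>x. frac (lift \<alpha> x)) \<in> borel_measurable f.M"
    by (rule f.measurable_borel_M) measurable
  have "emeasure g.M B = emeasure f.M ((\<lambda>x. frac (lift \<alpha> x)) -` B \<inter> {0..<1})"
    if B[measurable]: "B \<in> sets borel" and s: "B \<subseteq> {0..<1}" for B
  proof -
    interpret M: finite_measure f.M by (rule f.finite_M)
    interpret N: finite_measure g.M by (rule g.finite_M)
    let ?A = "(\<lambda>x. frac (lift \<alpha> x)) -` B \<inter> {0..<1}"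
    have A: "?A \<in> sets f.M" using measurable_sets[OF m B] by simp
    have "id \<in> borel_measurable g.M" by (rule g.measurable_borel_M) simp
    from measurable_sets[OF this B] have B': "B \<in> sets g.M" using s by (simp add: Int_absorb2)
    have "measure f.M ?A = (\<integral>x. indicator ?A x \<partial>f.M)" using A by simp
    \<comment> \<open>Composing the indicator with \<open>frac\<close> makes it periodic, as
      \<open>integral_lift\<close> requires; on the unit interval \<open>frac\<close> changes
      nothing.\<close>
    also have "\<dots> = (\<integral>x. indicator B (frac (lift \<alpha> x)) \<partial>f.M)"
      by (intro Bochner_Integration.integral_cong) (auto simp: indicator_def)
    also have "\<dots> = (\<integral>y. indicator B (frac y) \<partial>g.M)"
      by (rule integral_lift[where C = 1]) (auto simp: indicator_def frac_1_eq)
    also have "\<dots> = (\<integral>y. indicator B y \<partial>g.M)"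
      by (intro Bochner_Integration.integral_cong) (auto simp: indicator_def frac_eq)
    also have "\<dots> = measure g.M B" using B' s by (simp add: Int_absorb2)
    finally show ?thesis by (simp add: M.emeasure_eq_measure N.emeasure_eq_measure)
  qed
  then show ?thesis
    using m by (simp add: transport_maps_def measurable_restrict_space2_iff frac_lt_1)
qed

lemma transport_mapsD:
  assumes "T \<in> transport_maps f g"
  shows "T \<in> borel_measurable f.M" "\<And>x. 0 \<le> x \<Longrightarrow> x < 1 \<Longrightarrow> 0 \<le> T x \<and> T x < 1"
  using assms by (auto simp: transport_maps_def measurable_restrict_space2_iff Pi_iff)

lemma integral_transport:
  fixes h :: "real \<Rightarrow> real"
  assumes T: "T \<in> transport_maps f g" and h: "h \<in> borel_measurable borel"
  shows "(\<integral>x. h (T x) \<partial>f.M) = (\<integral>y. h y \<partial>g.M)"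
proof -
  note m = transport_mapsD[OF T]
  have id: "(\<lambda>x. x) \<in> borel_measurable g.M" by (rule g.measurable_borel_M) simp
  have "distr f.M borel T = distr g.M borel (\<lambda>x. x)"
  proof (rule measure_eqI)
    fix B assume "B \<in> sets (distr f.M borel T)"
    then have B: "B \<in> sets borel" by simp
    \<comment> \<open>\<open>transport_maps\<close> tests only Borel subsets of the unit interval; a
      general \<open>B\<close> may be cut down to it because \<open>T\<close> takes its values
      there.\<close>
    have "emeasure (distr f.M borel T) B = emeasure f.M (T -` (B \<inter> {0..<1}) \<inter> {0..<1})"
      using m B by (subst emeasure_distr) (auto intro!: arg_cong[where f = "emeasure f.M"])
    also have "\<dots> = emeasure g.M (B \<inter> {0..<1})"
      using T B by (simp add: transport_maps_def)
    also have "\<dots> = emeasure (distr g.M borel (\<lambda>x. x)) B"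
      using id B by (subst emeasure_distr) auto
    finally show "emeasure (distr f.M borel T) B = emeasure (distr g.M borel (\<lambda>x. x)) B" .
  qed simp
  then show ?thesis
    using integral_distr[OF m(1) h] integral_distr[OF id h] by simp
qed

lemma circle_dist_transport:
  assumes "T \<in> transport_maps f g"
  shows "(\<lambda>x. (circle_dist x (T x))\<^sup>2) \<in> borel_measurable f.M"
    and "0 \<le> x \<Longrightarrow> x < 1 \<Longrightarrow> \<bar>(circle_dist x (T x))\<^sup>2\<bar> \<le> 1"
proof -
  note [measurable] = transport_mapsD(1)[OF assms] f.measurable_borel_M[of "\<lambda>x. x", simplified]
  show "(\<lambda>x. (circle_dist x (T x))\<^sup>2) \<in> borel_measurable f.M"
    unfolding circle_dist_def by measurable
  show "0 \<le> x \<Longrightarrow> x < 1 \<Longrightarrow> \<bar>(circle_dist x (T x))\<^sup>2\<bar> \<le> 1"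
    using transport_mapsD(2)[OF assms] circle_dist_sq_le_1 by simp
qed

end

section \<open>Optimality from an abstract potential\<close>

lemma periodic_continuous_bounded:
  fixes \<psi> :: "real \<Rightarrow> real"
  assumes "continuous_on UNIV \<psi>" "\<And>t. \<psi> (t + 1) = \<psi> t"
  shows "\<exists>C. \<forall>t. \<bar>\<psi> t\<bar> \<le> C"
proof -
  have "compact (\<psi> ` {0..1})"
    by (intro compact_continuous_image continuous_on_subset[OF assms(1)]) auto
  then have "bounded (\<psi> ` {0..1})" by (rule compact_imp_bounded)
  then obtain C where C: "\<forall>t\<in>{0..1}. \<bar>\<psi> t\<bar> \<le> C"
    by (auto simp: bounded_iff)
  have "\<bar>\<psi> t\<bar> \<le> C" for t
    using C[rule_format, of "frac t"] periodic_frac[of \<psi> t, OF assms(2)] frac_lt_1[of t] by simp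
  then show ?thesis by blast
qed

text \<open>Collects what \<open>kantorovich_potential\<close> delivers, so that both costs can be
  compared with one dual value for a fixed \<open>\<alpha>\<close> and
  \<open>\<psi>\<close>.\<close>

locale transport_duality = transport_pair +
  fixes \<alpha> \<psi>
  assumes cont: "continuous_on UNIV \<psi>" and per: "\<And>t. \<psi> (t + 1) = \<psi> t"
    and potential: "\<And>x y. f.F x - \<alpha> \<notin> g.plateau \<Longrightarrow> y \<noteq> lift \<alpha> x \<Longrightarrow>
       (x - lift \<alpha> x)\<^sup>2 - \<psi> (lift \<alpha> x) < (x - y)\<^sup>2 - \<psi> y"
begin

text \<open>The conjugate potential: for almost every \<open>x\<close> it is the minimum over
  \<open>y\<close> of \<open>(x - y)^2 - \<psi> y\<close>.\<close>

definition \<phi> :: "real \<Rightarrow> real" where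
  "\<phi> x = (x - lift \<alpha> x)\<^sup>2 - \<psi> (lift \<alpha> x)"

definition dual_value :: real where
  "dual_value = (\<integral>x. \<phi> x \<partial>f.M) + (\<integral>y. \<psi> y \<partial>g.M)"

lemma AE_generic: "AE x in f.M. 0 \<le> x \<and> x < 1 \<and> f.F x - \<alpha> \<notin> g.plateau"
proof -
  have "AE x in f.M. f.F x \<notin> (\<lambda>v. v + \<alpha>) ` g.plateau"
    by (intro f.AE_F_notin countable_image g.countable_plateau)
  then show ?thesis
  proof (rule AE_mp, intro AE_I2 impI)
    fix x assume "x \<in> space f.M" "f.F x \<notin> (\<lambda>v. v + \<alpha>) ` g.plateau"
    then show "0 \<le> x \<and> x < 1 \<and> f.F x - \<alpha> \<notin> g.plateau"
      using image_eqI[of "f.F x" "\<lambda>v. v + \<alpha>" "f.F x - \<alpha>" g.plateau] by auto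
  qed
qed

lemma psi_borel[measurable]: "\<psi> \<in> borel_measurable borel"
  by (rule borel_measurable_continuous_onI[OF cont])

lemma psi_frac: "\<psi> (frac t) = \<psi> t"
  by (rule periodic_frac) (rule per)

text \<open>Weak duality with its equality case, for real lifts and transport maps alike. By
  \<open>eq\<close> the integral of \<open>\<phi> x + \<psi> (y x)\<close> is the dual value, and a
  nonnegative excess with integral zero vanishes almost everywhere.\<close>

lemma dual_bound:
  assumes c: "integrable f.M c" and y: "y \<in> borel_measurable f.M"
    and eq: "(\<integral>x. \<psi> (y x) \<partial>f.M) = (\<integral>y. \<psi> y \<partial>g.M)"
    and le: "AE x in f.M. \<phi> x + \<psi> (y x) \<le> c x"
  shows "dual_value \<le> (\<integral>x. c x \<partial>f.M)"
    and "(\<integral>x. c x \<partial>f.M) = dual_value \<longleftrightarrow> (AE x in f.M. c x = \<phi> x + \<psi> (y x))"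
proof -
  obtain C where C: "\<And>t. \<bar>\<psi> t\<bar> \<le> C"
    using periodic_continuous_bounded[OF cont per] by blast
  have "integrable f.M (\<lambda>x. (x - lift \<alpha> x)\<^sup>2)"
    by (rule f.integrable_M[OF f.measurable_borel_M, of _ "(2 + \<bar>\<alpha>\<bar>)\<^sup>2"]) (use lift_sq_bound in auto)
  moreover have "integrable f.M (\<lambda>x. \<psi> (lift \<alpha> x))"
    by (rule f.integrable_M[OF f.measurable_borel_M, of _ C]) (use C in auto)
  ultimately have i: "integrable f.M \<phi>"
    unfolding \<phi>_def[abs_def] by (rule Bochner_Integration.integrable_diff)
  have j: "integrable f.M (\<lambda>x. \<psi> (y x))"
    by (rule f.integrable_M[of _ C]) (use C y in auto)
  note ij = Bochner_Integration.integrable_add[OF i j]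
  have s: "(\<integral>x. \<phi> x + \<psi> (y x) \<partial>f.M) = dual_value"
    using Bochner_Integration.integral_add[OF i j] eq by (simp add: dual_value_def)
  show "dual_value \<le> (\<integral>x. c x \<partial>f.M)"
    unfolding s[symmetric] by (rule integral_mono_AE[OF ij c le])
  have "(\<integral>x. c x - (\<phi> x + \<psi> (y x)) \<partial>f.M) = 0 \<longleftrightarrow> (AE x in f.M. c x - (\<phi> x + \<psi> (y x)) = 0)"
    by (rule integral_nonneg_eq_0_iff_AE[OF Bochner_Integration.integrable_diff[OF c ij]]) (use le in auto)
  then show "(\<integral>x. c x \<partial>f.M) = dual_value \<longleftrightarrow> (AE x in f.M. c x = \<phi> x + \<psi> (y x))"
    using Bochner_Integration.integral_diff[OF c ij] s by simp
qed

lemma generic_le: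
  assumes "f.F x - \<alpha> \<notin> g.plateau"
  shows "\<phi> x + \<psi> y \<le> (x - y)\<^sup>2" "\<phi> x + \<psi> y = (x - y)\<^sup>2 \<Longrightarrow> y = lift \<alpha> x"
  using potential[OF assms, of y] by (cases "y = lift \<alpha> x"; simp add: \<phi>_def)+

lemma shift_cost_dual:
  shows "dual_value \<le> shift_cost f g \<beta>" and "shift_cost f g \<beta> = dual_value \<longleftrightarrow> \<beta> = \<alpha>"
proof -
  have c: "integrable f.M (\<lambda>x. (x - lift \<beta> x)\<^sup>2)"
    by (rule f.integrable_M[OF f.measurable_borel_M, of _ "(2 + \<bar>\<beta>\<bar>)\<^sup>2"]) (use lift_sq_bound in auto)
  obtain C where C: "\<And>t. \<bar>\<psi> t\<bar> \<le> C"
    using periodic_continuous_bounded[OF cont per] by blast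
  have eq: "(\<integral>x. \<psi> (lift \<beta> x) \<partial>f.M) = (\<integral>y. \<psi> y \<partial>g.M)"
    by (rule integral_lift[of \<psi> C, OF psi_borel C per])
  have le: "AE x in f.M. \<phi> x + \<psi> (lift \<beta> x) \<le> (x - lift \<beta> x)\<^sup>2"
    using AE_generic by eventually_elim (simp add: generic_le)
  note dual = dual_bound[OF c f.measurable_borel_M[OF lift_borel] eq le]
  show "dual_value \<le> shift_cost f g \<beta>"
    unfolding shift_cost_eq by (rule dual(1))
  show "shift_cost f g \<beta> = dual_value \<longleftrightarrow> \<beta> = \<alpha>"
  proof
    assume "shift_cost f g \<beta> = dual_value"
    then have "AE x in f.M. (x - lift \<beta> x)\<^sup>2 = \<phi> x + \<psi> (lift \<beta> x)"
      using dual(2) by (simp add: shift_cost_eq)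
    with AE_generic have AE: "AE x in f.M. lift \<beta> x = lift \<alpha> x"
      by eventually_elim (simp add: generic_le)
    \<comment> \<open>As \<open>f.M\<close> has total mass 1, an almost sure equality holds at some
      point; there injectivity of the inverse of \<open>G\<close> makes the shifts equal.\<close>
    have "\<exists>x. lift \<beta> x = lift \<alpha> x"
    proof (rule ccontr)
      assume "\<not> ?thesis"
      then have "AE x in f.M. False" using AE by simp
      then have "emeasure f.M (space f.M) = 0" by (simp add: AE_iff_measurable[OF sets.top] del: f.space_M)
      then show False using f.emeasure_space_M by simp
    qed
    then show "\<beta> = \<alpha>" by (auto simp: lift_def dest: g.R_inj)
  next
    assume "\<beta> = \<alpha>"
    then show "shift_cost f g \<beta> = dual_value"
      using dual(2) by (simp add: shift_cost_eq \<phi>_def)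
  qed
qed

lemma INF_shift_cost: "(INF \<beta>. shift_cost f g \<beta>) = dual_value"
  using shift_cost_dual(1) shift_cost_dual(2)[of \<alpha>]
  by (intro cInf_eq_minimum) (auto intro: image_eqI[of _ _ \<alpha>])

lemma transport_cost_dual:
  assumes T: "T \<in> transport_maps f g"
  shows "dual_value \<le> transport_cost f T"
    and "transport_cost f T = dual_value \<Longrightarrow> AE x in f.M. T x = frac (lift \<alpha> x)"
proof -
  note m = transport_mapsD[OF T]
  have c: "integrable f.M (\<lambda>x. (circle_dist x (T x))\<^sup>2)"
    by (rule f.integrable_M[of _ 1]) (use circle_dist_transport[OF T] in auto)
  have eq: "(\<integral>x. \<psi> (T x) \<partial>f.M) = (\<integral>y. \<psi> y \<partial>g.M)"
    by (rule integral_transport[OF T]) measurable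
  have pw: "\<phi> x + \<psi> (T x) \<le> (circle_dist x (T x))\<^sup>2 \<and>
      ((circle_dist x (T x))\<^sup>2 = \<phi> x + \<psi> (T x) \<longrightarrow> T x = frac (lift \<alpha> x))"
    if x: "0 \<le> x \<and> x < 1 \<and> f.F x - \<alpha> \<notin> g.plateau" for x
  proof -
    \<comment> \<open>\<open>w\<close> is a representative of \<open>T x\<close> nearest to
      \<open>x\<close>, so the inequality on the real line applies; by periodicity
      \<open>\<psi>\<close> does not see the change.\<close>
    obtain w where w: "frac w = T x" "circle_dist x (T x) = \<bar>x - w\<bar>"
      using circle_dist_attained[of x "T x"] m(2)[of x] x by blast
    have "\<psi> (T x) = \<psi> w" by (simp add: psi_frac flip: w(1))
    then show ?thesis using generic_le[of x w] x w by auto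
  qed
  have le: "AE x in f.M. \<phi> x + \<psi> (T x) \<le> (circle_dist x (T x))\<^sup>2"
    using AE_generic by eventually_elim (use pw in blast)
  note dual = dual_bound[OF c m(1) eq le]
  show "dual_value \<le> transport_cost f T"
    unfolding transport_cost_def by (rule dual(1))
  assume "transport_cost f T = dual_value"
  then have "AE x in f.M. (circle_dist x (T x))\<^sup>2 = \<phi> x + \<psi> (T x)"
    using dual(2) by (simp add: transport_cost_def)
  with AE_generic show "AE x in f.M. T x = frac (lift \<alpha> x)"
    by eventually_elim (use pw in blast)
qed

text \<open>Reduction modulo 1 can only shorten displacements, so this cost is at most
  \<open>shift_cost f g \<alpha>\<close>, which is the dual value; the reverse bound holds for every
  transport map.\<close>

lemma transport_cost_frac_lift: "transport_cost f (\<lambda>x. frac (lift \<alpha> x)) = dual_value"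
proof (rule antisym)
  note T = frac_lift_transport[of \<alpha>]
  have "transport_cost f (\<lambda>x. frac (lift \<alpha> x)) \<le> shift_cost f g \<alpha>"
    unfolding transport_cost_def shift_cost_eq
  proof (rule integral_mono)
    show "integrable f.M (\<lambda>x. (circle_dist x (frac (lift \<alpha> x)))\<^sup>2)"
      by (rule f.integrable_M[of _ 1]) (use circle_dist_transport[OF T] in auto)
    show "integrable f.M (\<lambda>x. (x - lift \<alpha> x)\<^sup>2)"
      by (rule f.integrable_M[OF f.measurable_borel_M, of _ "(2 + \<bar>\<alpha>\<bar>)\<^sup>2"]) (use lift_sq_bound in auto)
    fix x assume "x \<in> space f.M"
    then have x: "0 \<le> x" "x < 1" by auto
    have "0 \<le> circle_dist x (frac (lift \<alpha> x))"
      using x frac_ge_0[of "lift \<alpha> x"] frac_lt_1[of "lift \<alpha> x"] unfolding circle_dist_def by linarith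
    then have "(circle_dist x (frac (lift \<alpha> x)))\<^sup>2 \<le> \<bar>x - lift \<alpha> x\<bar>\<^sup>2"
      using circle_dist_le[OF x] by (intro power_mono)
    then show "(circle_dist x (frac (lift \<alpha> x)))\<^sup>2 \<le> (x - lift \<alpha> x)\<^sup>2" by simp
  qed
  then show "transport_cost f (\<lambda>x. frac (lift \<alpha> x)) \<le> dual_value"
    using shift_cost_dual(2)[of \<alpha>] by simp
qed (rule transport_cost_dual(1)[OF frac_lift_transport])

lemma wasserstein2_sq_eq: "wasserstein2_sq f g = dual_value"
  unfolding wasserstein2_sq_def
  using transport_cost_dual(1) transport_cost_frac_lift
  by (intro cInf_eq_minimum) (auto intro: image_eqI[where x = "\<lambda>x. frac (lift \<alpha> x)"] frac_lift_transport)

lemma optimal_frac_lift: "is_optimal_transport_map f g (\<lambda>x. frac (lift \<alpha> x))"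
  unfolding is_optimal_transport_map_def cost_minimizer_def wasserstein2_sq_eq
  using frac_lift_transport transport_cost_frac_lift transport_cost_dual(2) by blast

end

theorem theorem3p1:
  fixes f g :: "real \<Rightarrow> real"
  assumes "circle_density f" and "circle_density g"
  shows "wasserstein2_sq f g = (INF \<alpha>. shift_cost f g \<alpha>) \<and>
         (\<exists>!\<alpha>. shift_cost f g \<alpha> = (INF \<beta>. shift_cost f g \<beta>)) \<and>
         (\<forall>\<alpha>. shift_cost f g \<alpha> = (INF \<beta>. shift_cost f g \<beta>) \<longrightarrow>
              is_optimal_transport_map f g
                (\<lambda>t. frac ((shifted_inverse_df g \<alpha> \<circ> circle_cdf f) t)))"
proof -
  interpret transport_pair f g
    by unfold_locales (fact assms)+
  interpret circle_lift_pair "circle_cdf f" "circle_cdf g" ..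
  obtain \<alpha> \<psi> where "transport_duality f g \<alpha> \<psi>"
  proof (rule kantorovich_potential)
    fix \<psi> \<alpha>
    assume "continuous_on UNIV \<psi>" "\<And>t. \<psi> (t + 1) = \<psi> t"
      "\<And>x y. circle_cdf f x - \<alpha> \<notin> g.plateau \<Longrightarrow> y \<noteq> g.R (circle_cdf f x - \<alpha>) \<Longrightarrow>
         (x - g.R (circle_cdf f x - \<alpha>))\<^sup>2 - \<psi> (g.R (circle_cdf f x - \<alpha>)) < (x - y)\<^sup>2 - \<psi> y"
    then have "transport_duality f g \<alpha> \<psi>"
      by unfold_locales (auto simp: lift_def)
    then show ?thesis by (rule that)
  qed
  then interpret transport_duality f g \<alpha> \<psi> .
  have "(\<lambda>t. frac ((shifted_inverse_df g \<alpha> \<circ> circle_cdf f) t)) = (\<lambda>x. frac (lift \<alpha> x))"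
    by (simp add: shifted_inverse_df_eq lift_def)
  \<comment> \<open>By \<open>shift_cost_dual\<close> the infimum is attained exactly at this
    \<open>\<alpha>\<close>, so the claim about every minimising shift reduces to
    \<open>optimal_frac_lift\<close>.\<close>
  then show ?thesis
    using optimal_frac_lift by (auto simp: wasserstein2_sq_eq INF_shift_cost shift_cost_dual(2))
qed

end
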